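(* Let $\Sigma$ be a (possibly infinite) unranked signature, $\mathcal{X}$ an infinite set of variables disjoint from $\Sigma$, and $>$ a well-founded partial order on $\Sigma$. Let $\rightsquigarrow$ be the rewrite relation induced by the term rewrite system $\mathit{Star}$ on the trees $\mathbb{T}(\Sigma\cup\Sigma^\star,\mathcal{X})$. Then the restriction of the transitive closure $\rightsquigarrow^+$ to the star-free trees, i.e. the relation ${\rightsquigarrow^+}\cap(\mathbb{T}(\Sigma,\mathcal{X})\times\mathbb{T}(\Sigma,\mathcal{X}))$, is terminating (strongly normalizing): there is no infinite sequence $t_0,t_1,t_2,\ldots$ in $\mathbb{T}(\Sigma,\mathcal{X})$ with $t_i\rightsquigarrow^+ t_{i+1}$ for all $i$.
   Context: Terms: for an unranked signature $\Gamma$ (a set of symbols without fixed arity) and a set $\mathcal{X}$ of variables disjoint from $\Gamma$, the set of terms $\mathcal{T}(\Gamma,\mathcal{X})$ is the smallest set containing $\mathcal{X}$ and containing $f(t_1,\ldots,t_n)$ for all $f\in\Gamma$, $n\ge 0$ and terms $t_1,\ldots,t_n$. A term rewrite system is a set of rules $\ell\to r$; it induces on terms the rewrite relation $C[\sigma(\ell)]\to C[\sigma(r)]$ for all one-hole contexts $C$, rules $\ell\to r$ and substitutions $\sigma$. Trees: $\simeq$ is the equivalence relation on terms generated by swapping two adjacent arguments of a symbol anywhere inside a term, i.e. generated by the rewrite rules $f(\vec u,x,y,\vec w)\to f(\vec u,y,x,\vec w)$ for all symbols $f$. The set of (unordered) trees is $\mathbb{T}(\Gamma,\mathcal{X})=\mathcal{T}(\Gamma,\mathcal{X})/_{\simeq}$.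 A rewrite relation $\to$ on terms is extended to trees by: $[s]\to[t]$ whenever $s\to t$, for terms $s,t$ with classes $[s],[t]$. Starred signature: $\Sigma^\star=\{f^\star\mid f\in\Sigma\}$, a set of fresh symbols (disjoint from $\Sigma$). The system $\mathit{Star}$ over $\Sigma\cup\Sigma^\star$ consists of the following rules, for all $f,g\in\Sigma$, where $\vec x,\vec y,\vec z$ are finite (possibly empty) vectors of distinct variables: (put) $f(\vec x)\rightsquigarrow f^\star(\vec x)$; (select) $f^\star(\vec x,y,\vec z)\rightsquigarrow y$; (copy) $f^\star(\vec x)\rightsquigarrow g(f^\star(\vec x),\ldots,f^\star(\vec x))$ with $0$ or more copies of $f^\star(\vec x)$, if $f>g$; (down) $f^\star(\vec x,g(\vec y),\vec z)\rightsquigarrow f(\vec x,g^\star(\vec y),\ldots,g^\star(\vec y),\vec z)$ with $0$ or more copies of $g^\star(\vec y)$. *)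

theory Defs
  imports Main
begin

text \<open>
  Symbols are unranked: a symbol may be applied to any number of arguments. Variables and symbols
  are disjoint by construction.
\<close>

datatype ('f, 'v) trm = Var 'v | Fun 'f "('f, 'v) trm list"

inductive_set terms :: "'f set \<Rightarrow> 'v set \<Rightarrow> ('f, 'v) trm set"
  for \<Gamma> :: "'f set" and X :: "'v set" where
  Var: "x \<in> X \<Longrightarrow> Var x \<in> terms \<Gamma> X"
| Fun: "f \<in> \<Gamma> \<Longrightarrow> (\<And>t. t \<in> set ts \<Longrightarrow> t \<in> terms \<Gamma> X) \<Longrightarrow> Fun f ts \<in> terms \<Gamma> X"

primrec subst :: "('v \<Rightarrow> ('f, 'v) trm) \<Rightarrow> ('f, 'v) trm \<Rightarrow> ('f, 'v) trm" where
  "subst \<sigma> (Var x) = \<sigma> x"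
| "subst \<sigma> (Fun f ts) = Fun f (map (subst \<sigma>) ts)"

datatype ('f, 'v) ctxt = Hole | More 'f "('f, 'v) trm list" "('f, 'v) ctxt" "('f, 'v) trm list"

primrec fill :: "('f, 'v) ctxt \<Rightarrow> ('f, 'v) trm \<Rightarrow> ('f, 'v) trm" where
  "fill Hole t = t"
| "fill (More f us C ws) t = Fun f (us @ fill C t # ws)"

inductive_set ctxts :: "'f set \<Rightarrow> 'v set \<Rightarrow> ('f, 'v) ctxt set"
  for \<Gamma> :: "'f set" and X :: "'v set" where
  Hole: "Hole \<in> ctxts \<Gamma> X"
| More: "f \<in> \<Gamma> \<Longrightarrow> set us \<subseteq> terms \<Gamma> X \<Longrightarrow> C \<in> ctxts \<Gamma> X \<Longrightarrow> set ws \<subseteq> terms \<Gamma> X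
    \<Longrightarrow> More f us C ws \<in> ctxts \<Gamma> X"

type_synonym ('f, 'v) trs = "(('f, 'v) trm \<times> ('f, 'v) trm) set"

definition rstep :: "'f set \<Rightarrow> 'v set \<Rightarrow> ('f, 'v) trs \<Rightarrow> (('f, 'v) trm \<times> ('f, 'v) trm) set" where
  "rstep \<Gamma> X R = {(fill C (subst \<sigma> l), fill C (subst \<sigma> r)) | C \<sigma> l r.
     (l, r) \<in> R \<and> C \<in> ctxts \<Gamma> X \<and> (\<forall>x\<in>X. \<sigma> x \<in> terms \<Gamma> X)}"

definition swap_rules :: "'f set \<Rightarrow> 'v set \<Rightarrow> ('f, 'v) trs" where
  "swap_rules \<Gamma> X =
     {(Fun f (map Var (us @ [x, y] @ ws)), Fun f (map Var (us @ [y, x] @ ws))) | f us x y ws.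
       f \<in> \<Gamma> \<and> set (us @ [x, y] @ ws) \<subseteq> X \<and> distinct (us @ [x, y] @ ws)}"

text \<open>
  The equivalence relation on terms generated by the swap rules. Restricting it to \<open>terms \<Gamma> X\<close> only
  removes the reflexive pairs of terms that are not over \<open>\<Gamma>\<close> and \<open>X\<close>.
\<close>

definition tree_eq :: "'f set \<Rightarrow> 'v set \<Rightarrow> (('f, 'v) trm \<times> ('f, 'v) trm) set" where
  "tree_eq \<Gamma> X =
     (rstep \<Gamma> X (swap_rules \<Gamma> X) \<union> (rstep \<Gamma> X (swap_rules \<Gamma> X))\<inverse>)\<^sup>* \<inter> terms \<Gamma> X \<times> terms \<Gamma> X"

lemma equiv_tree_eq: "equiv (terms \<Gamma> X) (tree_eq \<Gamma> X)"
proof -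
  have "sym ((rstep \<Gamma> X (swap_rules \<Gamma> X) \<union> (rstep \<Gamma> X (swap_rules \<Gamma> X))\<inverse>)\<^sup>*)"
    by (intro sym_rtrancl sym_Un_converse)
  then show ?thesis
    by (auto simp: equiv_def refl_on_def sym_def trans_def tree_eq_def intro: rtrancl_trans)
qed

type_synonym ('f, 'v) tree = "('f, 'v) trm set"

definition trees :: "'f set \<Rightarrow> 'v set \<Rightarrow> ('f, 'v) tree set" where
  "trees \<Gamma> X = terms \<Gamma> X // tree_eq \<Gamma> X"

definition tree_of :: "'f set \<Rightarrow> 'v set \<Rightarrow> ('f, 'v) trm \<Rightarrow> ('f, 'v) tree" where
  "tree_of \<Gamma> X t = tree_eq \<Gamma> X `` {t}"

definition tree_rstep :: "'f set \<Rightarrow> 'v set \<Rightarrow> ('f, 'v) trs \<Rightarrow> (('f, 'v) tree \<times> ('f, 'v) tree) set" where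
  "tree_rstep \<Gamma> X R = {(tree_of \<Gamma> X s, tree_of \<Gamma> X t) | s t. (s, t) \<in> rstep \<Gamma> X R}"

text \<open>
  The class of a term does not depend on the ambient signature, as swapping changes neither the
  symbols nor the variables of a term.
\<close>

lemma Fun_in_terms_iff: "Fun f ts \<in> terms \<Gamma> X \<longleftrightarrow> f \<in> \<Gamma> \<and> set ts \<subseteq> terms \<Gamma> X"
  by (auto intro: terms.Fun elim: terms.cases)

lemma terms_mono:
  assumes "\<Gamma> \<subseteq> \<Delta>"
  shows "terms \<Gamma> X \<subseteq> terms \<Delta> X"
proof
  fix t assume "t \<in> terms \<Gamma> X"
  then show "t \<in> terms \<Delta> X"
    by induction (use assms in \<open>auto intro: terms.intros\<close>)
qed

lemma ctxts_mono:
  assumes "\<Gamma> \<subseteq> \<Delta>"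
  shows "ctxts \<Gamma> X \<subseteq> ctxts \<Delta> X"
proof
  fix C assume "C \<in> ctxts \<Gamma> X"
  then show "C \<in> ctxts \<Delta> X"
    by induction (use assms terms_mono[OF assms, of X] in \<open>auto intro!: ctxts.intros dest: subsetD\<close>)
qed

lemma fill_in_terms_iff:
  assumes "C \<in> ctxts \<Delta> X"
  shows "fill C u \<in> terms \<Gamma> X \<longleftrightarrow> C \<in> ctxts \<Gamma> X \<and> u \<in> terms \<Gamma> X"
  using assms
proof induction
  case Hole
  then show ?case by (auto intro: ctxts.Hole)
next
  case (More f us C ws)
  have "More f us C ws \<in> ctxts \<Gamma> X \<longleftrightarrow>
      f \<in> \<Gamma> \<and> set us \<subseteq> terms \<Gamma> X \<and> C \<in> ctxts \<Gamma> X \<and> set ws \<subseteq> terms \<Gamma> X"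
    by (auto intro: ctxts.More elim: ctxts.cases)
  with More.IH show ?case by (auto simp: Fun_in_terms_iff)
qed

lemma swap_step_restrict:
  assumes "(s, t) \<in> rstep \<Delta> X (swap_rules \<Delta> X)"
  shows "s \<in> terms \<Gamma> X \<longleftrightarrow> t \<in> terms \<Gamma> X"
    and "s \<in> terms \<Gamma> X \<Longrightarrow> (s, t) \<in> rstep \<Gamma> X (swap_rules \<Gamma> X)"
proof -
  obtain C \<sigma> f us x y ws where
    s: "s = fill C (subst \<sigma> (Fun f (map Var (us @ [x, y] @ ws))))" and
    t: "t = fill C (subst \<sigma> (Fun f (map Var (us @ [y, x] @ ws))))" and
    C: "C \<in> ctxts \<Delta> X" and
    vs: "set (us @ [x, y] @ ws) \<subseteq> X" "distinct (us @ [x, y] @ ws)"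
    using assms unfolding rstep_def swap_rules_def by blast
  show "s \<in> terms \<Gamma> X \<longleftrightarrow> t \<in> terms \<Gamma> X"
    unfolding s t fill_in_terms_iff[OF C] by (auto simp: Fun_in_terms_iff)
  assume "s \<in> terms \<Gamma> X"
  then have C': "C \<in> ctxts \<Gamma> X" and f: "f \<in> \<Gamma>"
    and \<sigma>: "\<forall>z\<in>set (us @ [x, y] @ ws). \<sigma> z \<in> terms \<Gamma> X"
    unfolding s fill_in_terms_iff[OF C] by (auto simp: Fun_in_terms_iff)
  define \<tau> where "\<tau> z = (if z \<in> set (us @ [x, y] @ ws) then \<sigma> z else Var z)" for z
  have "s = fill C (subst \<tau> (Fun f (map Var (us @ [x, y] @ ws))))"
    "t = fill C (subst \<tau> (Fun f (map Var (us @ [y, x] @ ws))))"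
    unfolding s t by (auto simp: \<tau>_def intro!: arg_cong[where f = "fill C"])
  moreover have "\<forall>z\<in>X. \<tau> z \<in> terms \<Gamma> X"
    using \<sigma> by (auto simp: \<tau>_def intro: terms.Var)
  moreover have "(Fun f (map Var (us @ [x, y] @ ws)), Fun f (map Var (us @ [y, x] @ ws)))
      \<in> swap_rules \<Gamma> X"
    using f vs unfolding swap_rules_def by blast
  ultimately show "(s, t) \<in> rstep \<Gamma> X (swap_rules \<Gamma> X)"
    using C' unfolding rstep_def by blast
qed

lemma tree_of_mono:
  assumes "\<Gamma> \<subseteq> \<Delta>" "s \<in> terms \<Gamma> X"
  shows "tree_of \<Delta> X s = tree_of \<Gamma> X s"
proof -
  let ?E = "\<lambda>\<Gamma>. rstep \<Gamma> X (swap_rules \<Gamma> X) \<union> (rstep \<Gamma> X (swap_rules \<Gamma> X))\<inverse>"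
  have "t \<in> terms \<Gamma> X \<and> (s, t) \<in> (?E \<Gamma>)\<^sup>*" if "(s, t) \<in> (?E \<Delta>)\<^sup>*" for t
    using that
  proof induction
    case base
    then show ?case using assms by simp
  next
    case (step t u)
    then have "u \<in> terms \<Gamma> X \<and> (t, u) \<in> ?E \<Gamma>"
      using swap_step_restrict[where \<Gamma> = \<Gamma> and X = X] by blast
    with step.IH show ?case by (meson rtrancl.rtrancl_into_rtrancl)
  qed
  moreover have "rstep \<Gamma> X (swap_rules \<Gamma> X) \<subseteq> rstep \<Delta> X (swap_rules \<Delta> X)"
    unfolding rstep_def swap_rules_def
    using assms(1) ctxts_mono[OF assms(1), of X] terms_mono[OF assms(1), of X] by blast
  then have "(?E \<Gamma>)\<^sup>* \<subseteq> (?E \<Delta>)\<^sup>*"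
    by (intro rtrancl_mono) blast
  ultimately show ?thesis
    using assms terms_mono[OF assms(1), of X] unfolding tree_of_def tree_eq_def by blast
qed

lemma trees_mono: "\<Gamma> \<subseteq> \<Delta> \<Longrightarrow> trees \<Gamma> X \<subseteq> trees \<Delta> X"
  using tree_of_mono[of \<Gamma> \<Delta> _ X] terms_mono[of \<Gamma> \<Delta> X]
  unfolding trees_def quotient_def tree_of_def by fast

text \<open>
  \<open>Plain ` \<Sigma>\<close> plays the role of the signature \<open>\<Sigma>\<close> and \<open>Star ` \<Sigma>\<close> that of the disjoint copy \<open>\<Sigma>\<^sup>\<star>\<close>.
\<close>

datatype 'f starred = Plain 'f | Star 'f

definition star_sig :: "'f set \<Rightarrow> 'f starred set" where
  "star_sig \<Sigma> = Plain ` \<Sigma> \<union> Star ` \<Sigma>"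

inductive_set star_rules :: "'f set \<Rightarrow> ('f \<Rightarrow> 'f \<Rightarrow> bool) \<Rightarrow> 'v set \<Rightarrow> ('f starred, 'v) trs"
  for \<Sigma> :: "'f set" and gt :: "'f \<Rightarrow> 'f \<Rightarrow> bool" and X :: "'v set" where
  put: "f \<in> \<Sigma> \<Longrightarrow> set xs \<subseteq> X \<Longrightarrow> distinct xs \<Longrightarrow>
    (Fun (Plain f) (map Var xs), Fun (Star f) (map Var xs)) \<in> star_rules \<Sigma> gt X"
| select: "f \<in> \<Sigma> \<Longrightarrow> set (xs @ y # zs) \<subseteq> X \<Longrightarrow> distinct (xs @ y # zs) \<Longrightarrow>
    (Fun (Star f) (map Var (xs @ y # zs)), Var y) \<in> star_rules \<Sigma> gt X"
| copy: "f \<in> \<Sigma> \<Longrightarrow> g \<in> \<Sigma> \<Longrightarrow> gt f g \<Longrightarrow> set xs \<subseteq> X \<Longrightarrow> distinct xs \<Longrightarrow>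
    (Fun (Star f) (map Var xs), Fun (Plain g) (replicate n (Fun (Star f) (map Var xs))))
      \<in> star_rules \<Sigma> gt X"
| down: "f \<in> \<Sigma> \<Longrightarrow> g \<in> \<Sigma> \<Longrightarrow> set (xs @ ys @ zs) \<subseteq> X \<Longrightarrow> distinct (xs @ ys @ zs) \<Longrightarrow>
    (Fun (Star f) (map Var xs @ Fun (Plain g) (map Var ys) # map Var zs),
     Fun (Plain f) (map Var xs @ replicate n (Fun (Star g) (map Var ys)) @ map Var zs))
      \<in> star_rules \<Sigma> gt X"

end

theory Submission
  imports Defs "HOL-Library.Multiset" "HOL-Library.Extended_Nat"
begin

text \<open>
  A finite reduction of length \<open>n\<close> only ever needs stars that can be used \<open>n\<close> times. So we attach to
  every star a natural number that bounds how often it may still be used by (copy) and (down), and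
  regard an unstarred symbol as labelled by \<open>\<infinity>\<close>. Labelled trees terminate without
  restriction: if the arguments of \<open>f\<close> terminate then so does the tree, by induction on the
  triple of the symbol, the multiset of arguments and the label, compared lexicographically. Every
  reduction between star-free trees lifts to a labelled one by choosing the labels in (put) large
  enough, and the end of the lifted reduction is again unlabelled.
\<close>

section \<open>Labelled trees and their termination\<close>

datatype ('f, 'v) ltree = LVar 'v | LFun 'f enat "('f, 'v) ltree multiset"

text \<open>In \<open>copy\<close> the star survives inside its own result, so without a decreasing
  label (copy) could be repeated forever. \<open>select\<close> discards the star it uses, so a
  label of 0 suffices there.\<close>

inductive lstep :: "('f \<Rightarrow> 'f \<Rightarrow> bool) \<Rightarrow> ('f, 'v) ltree \<Rightarrow> ('f, 'v) ltree \<Rightarrow> bool"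
  for gt :: "'f \<Rightarrow> 'f \<Rightarrow> bool" where
  put: "lstep gt (LFun f \<infinity> M) (LFun f (enat n) M)"
| select: "t \<in># M \<Longrightarrow> lstep gt (LFun f (enat n) M) t"
| copy: "gt f g \<Longrightarrow>
    lstep gt (LFun f (enat (Suc n)) M) (LFun g \<infinity> (replicate_mset k (LFun f (enat n) M)))"
| down: "lstep gt (LFun f (enat (Suc n)) (add_mset (LFun g \<infinity> N) M))
    (LFun f \<infinity> (replicate_mset k (LFun g (enat n) N) + M))"
| arg: "lstep gt s t \<Longrightarrow> lstep gt (LFun f l (add_mset s M)) (LFun f l (add_mset t M))"

abbreviation SN :: "('f \<Rightarrow> 'f \<Rightarrow> bool) \<Rightarrow> ('f, 'v) ltree \<Rightarrow> bool" where
  "SN gt \<equiv> Wellfounded.accp (\<lambda>t s. lstep gt s t)"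

lemma SN_I: "(\<And>t. lstep gt s t \<Longrightarrow> SN gt t) \<Longrightarrow> SN gt s"
  by (auto intro: accpI)

lemma SN_lstep: "SN gt s \<Longrightarrow> lstep gt s t \<Longrightarrow> SN gt t"
  by (auto dest: accp_downward)

text \<open>Multiset extensions need a globally well-founded relation, while accessibility speaks of
  single trees. Keeping only the steps that start in \<open>SN\<close> bridges the two.\<close>

lemma wf_SN_lstep: "wf {(t, s). SN gt s \<and> lstep gt s t}"
proof (rule wfUNIVI)
  fix P s
  assume "\<forall>s. (\<forall>t. (t, s) \<in> {(t, s). SN gt s \<and> lstep gt s t} \<longrightarrow> P t) \<longrightarrow> P s"
  then have IH: "P s" if "\<And>t. SN gt s \<Longrightarrow> lstep gt s t \<Longrightarrow> P t" for s
    using that by blast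
  have "P s" if "SN gt s"
    using that
  proof (induction rule: accp_induct_rule)
    case (1 s)
    then show ?case using IH by blast
  qed
  \<comment> \<open>A tree outside \<open>SN\<close> has no predecessors in this relation, so
    \<open>IH\<close> applies vacuously.\<close>
  then show "P s" using IH by blast
qed

text \<open>\<open>put\<close> lowers only the label. \<open>copy\<close> lowers the symbol, once
  its new arguments are known to terminate by the smaller label. \<open>down\<close> and
  \<open>arg\<close> keep the symbol and lower the multiset of arguments, which is compared before
  the label, so \<open>down\<close> may raise the label back to \<open>\<infinity>\<close>.
  \<open>select\<close> returns an argument.\<close>

lemma SN_LFun:
  fixes M :: "('f, 'v) ltree multiset"
  assumes wf: "wfp (\<lambda>f g. gt g f)"
    and "\<And>t. t \<in># M \<Longrightarrow> SN gt t"
  shows "SN gt (LFun f l M)"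
  using assms(2)
proof (induction f arbitrary: l M rule: wfp_induct_rule[OF wf])
  case (1 f)
  note less_symbol = 1(1)
  define r :: "('f, 'v) ltree rel" where "r = {(t, s). SN gt s \<and> lstep gt s t}"
  have wf_mult_r: "wf (mult r)"
    unfolding r_def by (rule wf_mult[OF wf_SN_lstep])
  \<comment> \<open>Serves both cases that change the arguments: \<open>down\<close> replaces one
    argument by \<open>k\<close> reducts, possibly none, and \<open>arg\<close> by exactly
    one.\<close>
  have mult_rI: "(K + M, add_mset s M) \<in> mult r"
    if "SN gt s" "\<And>t. t \<in># K \<Longrightarrow> lstep gt s t" for s K M
    using that unfolding mult_def r_def
    by (intro r_into_trancl mult1I[OF refl add.commute]) auto
  show ?case
    using 1(2)
  proof (induction M arbitrary: l rule: wf_induct_rule[OF wf_mult_r])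
    case (1 M)
    note less_args = 1(1) and SN_args = 1(2)
    show ?case
    proof (induction l rule: less_induct)
      case (less l)
      show ?case
      proof (rule SN_I)
        fix u assume "lstep gt (LFun f l M) u"
        then show "SN gt u"
        proof cases
          case (put n)
          show ?thesis
            unfolding put(2) by (rule less) (simp add: put(1))
        next
          case (select n)
          show ?thesis by (rule SN_args) (fact select(2))
        next
          case (copy g n k)
          have "SN gt (LFun f (enat n) M)"
            by (rule less) (simp add: copy(1))
          then show ?thesis
            unfolding copy(2) by (intro less_symbol[OF copy(3)]) (simp split: if_splits)
        next
          case (down n g N M' k)
          \<comment> \<open>The copies created by \<open>down\<close> are one and the same
            \<open>put\<close>-reduct of the removed argument, so they terminate and lie below it in
            \<open>r\<close>.\<close>
          have SN_g: "SN gt (LFun g \<infinity> N)" by (rule SN_args) (simp add: down)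
          have step: "lstep gt (LFun g \<infinity> N) (LFun g (enat n) N)"
            by (rule lstep.put)
          show ?thesis
            unfolding down
          proof (rule less_args)
            show "(replicate_mset k (LFun g (enat n) N) + M', M) \<in> mult r"
              unfolding down by (rule mult_rI[OF SN_g]) (use step in \<open>auto split: if_splits\<close>)
          next
            fix t assume "t \<in># replicate_mset k (LFun g (enat n) N) + M'"
            then consider "t = LFun g (enat n) N" | "t \<in># M"
              by (auto simp: down split: if_splits)
            then show "SN gt t"
              by cases (use SN_lstep[OF SN_g step] SN_args in blast)+
          qed
        next
          case (arg s t M')
          have SN_s: "SN gt s" by (rule SN_args) (simp add: arg)
          show ?thesis
            unfolding arg
          proof (rule less_args)
            show "(add_mset t M', M) \<in> mult r"
              using mult_rI[OF SN_s, of "{#t#}" M'] arg by simp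
          next
            fix t' assume "t' \<in># add_mset t M'"
            then consider "t' = t" | "t' \<in># M"
              by (auto simp: arg)
            then show "SN gt t'"
              by cases (use SN_lstep[OF SN_s arg(3)] SN_args in blast)+
          qed
        qed
      qed
    qed
  qed
qed

lemma SN_all:
  assumes "wfp (\<lambda>f g. gt g f)"
  shows "SN gt t"
proof (induction t)
  case (LVar x)
  show ?case by (rule SN_I) (auto elim: lstep.cases)
next
  case (LFun f l M)
  then show ?case by (rule SN_LFun[OF assms])
qed

lemma wfp_lstep_tranclp:
  assumes "wfp (\<lambda>f g. gt g f)"
  shows "wfp ((lstep gt :: ('f, 'v) ltree \<Rightarrow> ('f, 'v) ltree \<Rightarrow> bool)\<^sup>+\<^sup>+)\<inverse>\<inverse>"
proof -
  have "wfp (\<lambda>t s :: ('f, 'v) ltree. lstep gt s t)"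
    using SN_all[OF assms] by (intro accp_wfpI allI)
  then have "wfp (lstep gt :: ('f, 'v) ltree \<Rightarrow> _)\<inverse>\<inverse>"
    by (simp add: conversep_iff[abs_def])
  then show ?thesis
    unfolding tranclp_converse[symmetric] by (rule wfp_tranclp)
qed

section \<open>Labellings of starred terms\<close>

text \<open>The lower bound \<open>k\<close> on the labels is the number of steps that \<open>s\<close> can still simulate.\<close>

inductive labels :: "nat \<Rightarrow> ('f starred, 'v) trm \<Rightarrow> ('f, 'v) ltree \<Rightarrow> bool" for k where
  Var: "labels k (Var x) (LVar x)"
| Plain: "list_all2 (labels k) ts Ls \<Longrightarrow> labels k (Fun (Plain f) ts) (LFun f \<infinity> (mset Ls))"
| Star: "list_all2 (labels k) ts Ls \<Longrightarrow> k \<le> n \<Longrightarrow>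
    labels k (Fun (Star f) ts) (LFun f (enat n) (mset Ls))"

lemma labels_FunE:
  assumes "labels k (Fun h ts) L"
  obtains
    (Plain) f Ls where "h = Plain f" "L = LFun f \<infinity> (mset Ls)" "list_all2 (labels k) ts Ls"
  | (Star) f n Ls where "h = Star f" "L = LFun f (enat n) (mset Ls)"
      "list_all2 (labels k) ts Ls" "k \<le> n"
  using assms by cases

inductive_cases labels_PlainE: "labels k (Fun (Plain f) ts) L"
inductive_cases labels_StarE: "labels k (Fun (Star f) ts) L"

lemma labels_mono:
  assumes "labels k s L" "j \<le> k"
  shows "labels j s L"
  using assms
  by induction (auto intro!: labels.intros elim: list.rel_mono_strong)

lemma labels_list_mono:
  "list_all2 (labels k) ts Ls \<Longrightarrow> j \<le> k \<Longrightarrow> list_all2 (labels j) ts Ls"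
  by (auto intro: labels_mono elim: list.rel_mono_strong)

text \<open>Only stars are constrained by the bound, so without them the same labelled tree serves
  every budget. This is what renews the budget at each star-free tree.\<close>

lemma labels_star_free:
  assumes "labels k s L" "s \<in> terms (Plain ` \<Sigma>) X"
  shows "labels j s L"
  using assms
  by induction
    (auto simp: Fun_in_terms_iff intro!: labels.intros elim!: list.rel_mono_strong)

lemma ex_labels: "\<exists>L. labels k s L"
proof (induction s)
  case (Var x)
  then show ?case by (blast intro: labels.Var)
next
  case (Fun h ts)
  then obtain F where "\<forall>t\<in>set ts. labels k t (F t)"
    by metis
  then have "list_all2 (labels k) ts (map F ts)"
    by (simp add: list_all2_conv_all_nth)
  then show ?case
    by (cases h) (blast intro: labels.intros)+
qed

text \<open>Closure under contexts, generic in \<open>Q\<close> because it is needed both for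
  equality (swaps) and for \<open>lstep\<close> (star steps). Labels in the context stay as they
  are; only the bound required of them weakens from \<open>j\<close> to \<open>k\<close>.\<close>

lemma labels_fill:
  assumes "k \<le> j"
    and hole: "\<And>L. labels j a L \<Longrightarrow> \<exists>L'. Q L L' \<and> labels k b L'"
    and Q: "\<And>L L' f l M. Q L L' \<Longrightarrow> Q (LFun f l (add_mset L M)) (LFun f l (add_mset L' M))"
    and "labels j (fill C a) L"
  shows "\<exists>L'. Q L L' \<and> labels k (fill C b) L'"
  using assms(4)
proof (induction C arbitrary: L)
  case Hole
  then show ?case using hole by simp
next
  case (More h us C ws)
  have ex: "\<exists>Ks. Q (LFun f l (mset Ls)) (LFun f l (mset Ks)) \<and>
      list_all2 (labels k) (us @ fill C b # ws) Ks"
    if "list_all2 (labels j) (us @ fill C a # ws) Ls" for f l Ls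
  proof -
    from that obtain Us L Ws where
      Ls: "Ls = Us @ L # Ws" and
      us: "list_all2 (labels j) us Us" and ws: "list_all2 (labels j) ws Ws" and
      L: "labels j (fill C a) L"
      by (auto simp: list_all2_append1 list_all2_Cons1)
    obtain L' where L': "Q L L'" "labels k (fill C b) L'" using More.IH[OF L] by blast
    have "list_all2 (labels k) (us @ fill C b # ws) (Us @ L' # Ws)"
      using us ws L' labels_list_mono[OF _ assms(1)] by (auto intro: list_all2_appendI)
    moreover have "Q (LFun f l (mset Ls)) (LFun f l (mset (Us @ L' # Ws)))"
      using Q[OF L'(1), of f l "mset Us + mset Ws"] unfolding Ls by simp
    ultimately show ?thesis by blast
  qed
  from More.prems have "labels j (Fun h (us @ fill C a # ws)) L" by simp
  then show ?case
  proof (cases rule: labels_FunE)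
    case (Plain f Ls)
    from ex[OF Plain(3)] obtain Ks where
      Ks: "Q L (LFun f \<infinity> (mset Ks))" "list_all2 (labels k) (us @ fill C b # ws) Ks"
      unfolding Plain(2) by blast
    from labels.Plain[OF Ks(2)] Ks(1) show ?thesis unfolding Plain(1) by auto
  next
    case (Star f n Ls)
    from ex[OF Star(3)] obtain Ks where
      Ks: "Q L (LFun f (enat n) (mset Ks))" "list_all2 (labels k) (us @ fill C b # ws) Ks"
      unfolding Star(2) by blast
    have "k \<le> n" using assms(1) Star(4) by simp
    from labels.Star[OF Ks(2) this] Ks(1) show ?thesis unfolding Star(1) by auto
  qed
qed

section \<open>Invariance of labellings under swapping\<close>

text \<open>Labelled trees keep their arguments in a multiset, so the order of \<open>a\<close> and
  \<open>b\<close> is already forgotten in \<open>L\<close>.\<close>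

lemma labels_swap_args:
  assumes "labels k (Fun h (us @ [a, b] @ ws)) L"
  shows "labels k (Fun h (us @ [b, a] @ ws)) L"
proof -
  have ex: "\<exists>Ks. mset Ks = mset Ls \<and> list_all2 (labels k) (us @ [b, a] @ ws) Ks"
    if "list_all2 (labels k) (us @ [a, b] @ ws) Ls" for Ls
  proof -
    from that obtain Us A B Ws where
      "Ls = Us @ [A, B] @ Ws" "list_all2 (labels k) us Us" "list_all2 (labels k) ws Ws"
      "labels k a A" "labels k b B"
      by (auto simp: list_all2_append1 list_all2_Cons1)
    then show ?thesis
      by (intro exI[of _ "Us @ [B, A] @ Ws"]) (auto intro: list_all2_appendI)
  qed
  from assms show ?thesis
  proof (cases rule: labels_FunE)
    case (Plain f Ls)
    then show ?thesis using ex[of Ls] by (metis labels.Plain)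
  next
    case (Star f n Ls)
    then show ?thesis using ex[of Ls] by (metis labels.Star)
  qed
qed

lemma labels_swap_step:
  assumes "(s, t) \<in> rstep \<Gamma> X (swap_rules \<Gamma> X)"
  shows "labels k s L \<longleftrightarrow> labels k t L"
proof -
  obtain C \<sigma> f us x y ws where
    s: "s = fill C (subst \<sigma> (Fun f (map Var (us @ [x, y] @ ws))))" and
    t: "t = fill C (subst \<sigma> (Fun f (map Var (us @ [y, x] @ ws))))"
    using assms unfolding rstep_def swap_rules_def by blast
  have swap: "labels k (subst \<sigma> (Fun f (map Var (us @ [x, y] @ ws)))) K \<Longrightarrow>
      labels k (subst \<sigma> (Fun f (map Var (us @ [y, x] @ ws)))) K" for x y K
    using labels_swap_args[of k f "map \<sigma> us" "\<sigma> x" "\<sigma> y" "map \<sigma> ws" K]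
    by (simp add: comp_def)
  have "labels k (fill C (subst \<sigma> (Fun f (map Var (us @ [y, x] @ ws))))) L"
    if "labels k (fill C (subst \<sigma> (Fun f (map Var (us @ [x, y] @ ws))))) L" for x y
    \<comment> \<open>With equality as \<open>Q\<close>, the labelled tree does not change at all.
      Generality in \<open>x\<close> and \<open>y\<close> then yields both directions.\<close>
    using labels_fill[of k k _ "(=)" _ C L, OF _ _ _ that] swap by blast
  then show ?thesis unfolding s t by blast
qed

lemma labels_tree_eq:
  assumes "(s, t) \<in> tree_eq \<Gamma> X" "labels k s L"
  shows "labels k t L"
proof -
  have "(s, t) \<in> (rstep \<Gamma> X (swap_rules \<Gamma> X) \<union> (rstep \<Gamma> X (swap_rules \<Gamma> X))\<inverse>)\<^sup>*"
    using assms(1) by (simp add: tree_eq_def)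
  then show ?thesis
  proof induction
    case base
    show ?case by (rule assms(2))
  next
    case (step t u)
    then show ?case using labels_swap_step by (metis UnE converseD)
  qed
qed

section \<open>Lifting star steps to labelled steps\<close>

text \<open>No rule needs to lower an existing label by more than one, and new stars can be given
  labels of at least \<open>k\<close>; hence one unit of the bound pays for one step.\<close>

lemma labels_star_rule:
  assumes "(l, r) \<in> star_rules \<Sigma> gt X" "labels (Suc k) (subst \<sigma> l) L"
  shows "\<exists>L'. lstep (\<lambda>f g. f \<in> \<Sigma> \<and> g \<in> \<Sigma> \<and> gt f g) L L' \<and> labels k (subst \<sigma> r) L'"
  using assms
proof cases
  case (put f xs)
  then have "labels (Suc k) (Fun (Plain f) (map \<sigma> xs)) L"
    using assms(2) by (simp add: comp_def)
  then obtain Ls where L: "L = LFun f \<infinity> (mset Ls)" "list_all2 (labels (Suc k)) (map \<sigma> xs) Ls"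
    by (auto elim: labels_PlainE)
  \<comment> \<open>The new star gets label \<open>k\<close>, the least value that the remaining
    budget permits.\<close>
  then have "labels k (Fun (Star f) (map \<sigma> xs)) (LFun f (enat k) (mset Ls))"
    by (intro labels.Star labels_list_mono[OF L(2)]) simp_all
  with put L show ?thesis by (auto simp: comp_def intro: lstep.put)
next
  case (select f xs y zs)
  then have "labels (Suc k) (Fun (Star f) (map \<sigma> xs @ \<sigma> y # map \<sigma> zs)) L"
    using assms(2) by (simp add: comp_def)
  then obtain Ls n where L: "L = LFun f (enat n) (mset Ls)"
    "list_all2 (labels (Suc k)) (map \<sigma> xs @ \<sigma> y # map \<sigma> zs) Ls"
    by (auto elim: labels_StarE)
  from L(2) obtain Xs K Zs where "Ls = Xs @ K # Zs" and K: "labels (Suc k) (\<sigma> y) K"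
    by (auto simp: list_all2_append1 list_all2_Cons1)
  then have "lstep (\<lambda>f g. f \<in> \<Sigma> \<and> g \<in> \<Sigma> \<and> gt f g) L K"
    unfolding L(1) by (intro lstep.select) simp
  moreover have "labels k (subst \<sigma> r) K"
    using labels_mono[OF K] select by simp
  ultimately show ?thesis by blast
next
  case (copy f g xs n)
  then have "labels (Suc k) (Fun (Star f) (map \<sigma> xs)) L"
    using assms(2) by (simp add: comp_def)
  then obtain Ls m where L: "L = LFun f (enat m) (mset Ls)" "Suc k \<le> m"
    "list_all2 (labels (Suc k)) (map \<sigma> xs) Ls"
    by (auto elim: labels_StarE)
  \<comment> \<open>The bound \<open>Suc k\<close> makes the label positive, and after one use it
    still covers the remaining budget \<open>k\<close>.\<close>
  then obtain m' where m': "m = Suc m'" "k \<le> m'" by (cases m) auto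
  let ?K = "LFun f (enat m') (mset Ls)"
  have "labels k (Fun (Star f) (map \<sigma> xs)) ?K"
    using m' by (intro labels.Star labels_list_mono[OF L(3)]) simp_all
  then have "labels k (Fun (Plain g) (replicate n (Fun (Star f) (map \<sigma> xs))))
      (LFun g \<infinity> (mset (replicate n ?K)))"
    by (intro labels.Plain) (simp add: list_all2_conv_all_nth)
  then have "labels k (subst \<sigma> r) (LFun g \<infinity> (replicate_mset n ?K))"
    using copy by (simp add: comp_def)
  moreover have "lstep (\<lambda>f g. f \<in> \<Sigma> \<and> g \<in> \<Sigma> \<and> gt f g) L (LFun g \<infinity> (replicate_mset n ?K))"
    unfolding L(1) m'(1) using copy by (intro lstep.copy) simp
  ultimately show ?thesis by blast
next
  case (down f g xs ys zs n)
  then have "labels (Suc k) (Fun (Star f) (map \<sigma> xs @ Fun (Plain g) (map \<sigma> ys) # map \<sigma> zs)) L"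
    using assms(2) by (simp add: comp_def)
  then obtain Ls m where L: "L = LFun f (enat m) (mset Ls)" "Suc k \<le> m"
    "list_all2 (labels (Suc k)) (map \<sigma> xs @ Fun (Plain g) (map \<sigma> ys) # map \<sigma> zs) Ls"
    by (auto elim: labels_StarE)
  from L(3) obtain Xs K Zs where Ls: "Ls = Xs @ K # Zs"
    "list_all2 (labels (Suc k)) (map \<sigma> xs) Xs" "list_all2 (labels (Suc k)) (map \<sigma> zs) Zs"
    "labels (Suc k) (Fun (Plain g) (map \<sigma> ys)) K"
    by (auto simp: list_all2_append1 list_all2_Cons1)
  from Ls(4) obtain Ys where
    K: "K = LFun g \<infinity> (mset Ys)" "list_all2 (labels (Suc k)) (map \<sigma> ys) Ys"
    by (auto elim: labels_PlainE)
  from L obtain m' where m': "m = Suc m'" "k \<le> m'" by (cases m) auto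
  \<comment> \<open>The label \<open>m'\<close> is what remains of the star on \<open>f\<close>; all
    \<open>n\<close> copies share this one labelled tree.\<close>
  let ?K = "LFun g (enat m') (mset Ys)"
  have "labels k (Fun (Star g) (map \<sigma> ys)) ?K"
    using m' by (intro labels.Star labels_list_mono[OF K(2)]) simp_all
  then have "list_all2 (labels k) (replicate n (Fun (Star g) (map \<sigma> ys))) (replicate n ?K)"
    by (simp add: list_all2_conv_all_nth)
  then have "labels k (Fun (Plain f)
        (map \<sigma> xs @ replicate n (Fun (Star g) (map \<sigma> ys)) @ map \<sigma> zs))
      (LFun f \<infinity> (mset (Xs @ replicate n ?K @ Zs)))"
    by (intro labels.Plain list_all2_appendI labels_list_mono[OF Ls(2)]
        labels_list_mono[OF Ls(3)]) simp_all
  then have "labels k (subst \<sigma> r) (LFun f \<infinity> (mset (Xs @ replicate n ?K @ Zs)))"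
    using down by (simp add: comp_def)
  moreover have "mset Ls = add_mset (LFun g \<infinity> (mset Ys)) (mset Xs + mset Zs)"
    using Ls K by simp
  then have "lstep (\<lambda>f g. f \<in> \<Sigma> \<and> g \<in> \<Sigma> \<and> gt f g) L
      (LFun f \<infinity> (mset (Xs @ replicate n ?K @ Zs)))"
    unfolding L(1) m'(1)
    using lstep.down[of _ f m' g "mset Ys" "mset Xs + mset Zs" n] by (simp add: ac_simps)
  ultimately show ?thesis by blast
qed

lemma labels_star_step:
  assumes "(s, t) \<in> rstep \<Gamma> X (star_rules \<Sigma> gt X)" "labels (Suc k) s L"
  shows "\<exists>L'. lstep (\<lambda>f g. f \<in> \<Sigma> \<and> g \<in> \<Sigma> \<and> gt f g) L L' \<and> labels k t L'"
proof -
  obtain C \<sigma> l r where s: "s = fill C (subst \<sigma> l)" and t: "t = fill C (subst \<sigma> r)"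
    and lr: "(l, r) \<in> star_rules \<Sigma> gt X"
    using assms(1) unfolding rstep_def by blast
  show ?thesis
    using assms(2) unfolding s t
    \<comment> \<open>Here \<open>Q\<close> becomes \<open>lstep\<close>, whose closure under
      contexts is \<open>lstep.arg\<close>.\<close>
    by (intro labels_fill[where j = "Suc k" and a = "subst \<sigma> l"])
      (auto intro: labels_star_rule[OF lr] lstep.arg)
qed

section \<open>Lifting reductions on trees\<close>

lemma subst_in_terms:
  assumes "t \<in> terms \<Gamma> X" "\<forall>x\<in>X. \<sigma> x \<in> terms \<Gamma> X"
  shows "subst \<sigma> t \<in> terms \<Gamma> X"
  using assms by induction (auto simp: Fun_in_terms_iff)

lemma star_rules_in_terms:
  assumes "(l, r) \<in> star_rules \<Sigma> gt X"
  shows "l \<in> terms (star_sig \<Sigma>) X \<and> r \<in> terms (star_sig \<Sigma>) X"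
proof -
  have Var: "Var x \<in> terms \<Gamma> X \<longleftrightarrow> x \<in> X" for x and \<Gamma> :: "'a starred set"
    by (auto intro: terms.Var elim: terms.cases)
  show ?thesis
    using assms
    by cases (auto simp: Fun_in_terms_iff Var star_sig_def subset_iff split: if_splits)
qed

text \<open>Ensures that the target of a step belongs to its own class, since \<open>tree_eq\<close>
  is reflexive only on terms over the signature.\<close>

lemma star_step_in_terms:
  assumes "(s, t) \<in> rstep (star_sig \<Sigma>) X (star_rules \<Sigma> gt X)"
  shows "t \<in> terms (star_sig \<Sigma>) X"
proof -
  obtain C \<sigma> l r where t: "t = fill C (subst \<sigma> r)" and C: "C \<in> ctxts (star_sig \<Sigma>) X"
    and lr: "(l, r) \<in> star_rules \<Sigma> gt X" and \<sigma>: "\<forall>x\<in>X. \<sigma> x \<in> terms (star_sig \<Sigma>) X"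
    using assms unfolding rstep_def by blast
  show ?thesis
    using C subst_in_terms[OF _ \<sigma>] star_rules_in_terms[OF lr]
    unfolding t fill_in_terms_iff[OF C] by blast
qed

lemma labels_tree_step:
  assumes "(S, T) \<in> tree_rstep (star_sig \<Sigma>) X (star_rules \<Sigma> gt X)"
    and "s \<in> S" "labels (Suc k) s L"
  shows "\<exists>L'. lstep (\<lambda>f g. f \<in> \<Sigma> \<and> g \<in> \<Sigma> \<and> gt f g) L L' \<and> (\<exists>t\<in>T. labels k t L')"
proof -
  let ?\<Gamma> = "star_sig \<Sigma>"
  obtain s' t where S: "S = tree_of ?\<Gamma> X s'" and T: "T = tree_of ?\<Gamma> X t"
    and st: "(s', t) \<in> rstep ?\<Gamma> X (star_rules \<Sigma> gt X)"
    using assms(1) unfolding tree_rstep_def by blast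
  \<comment> \<open>The step starts at a representative \<open>s'\<close> that may differ from
    \<open>s\<close>; the labelling \<open>L\<close> moves there unchanged.\<close>
  have "(s, s') \<in> tree_eq ?\<Gamma> X"
    using assms(2) equiv_tree_eq[of ?\<Gamma> X] unfolding S tree_of_def
    by (auto simp: equiv_def dest: symD)
  then have "labels (Suc k) s' L" using assms(3) by (rule labels_tree_eq)
  moreover have "t \<in> T"
    using star_step_in_terms[OF st] by (simp add: T tree_of_def tree_eq_def)
  ultimately show ?thesis using labels_star_step[OF st] by blast
qed

text \<open>Each step costs one unit of the bound, so a bound equal to the length \<open>n\<close>
  lasts exactly to the end.\<close>

lemma labels_tree_steps:
  assumes "(S, T) \<in> tree_rstep (star_sig \<Sigma>) X (star_rules \<Sigma> gt X) ^^ n"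
    and "s \<in> S" "labels n s L"
  shows "\<exists>L'. (lstep (\<lambda>f g. f \<in> \<Sigma> \<and> g \<in> \<Sigma> \<and> gt f g) ^^ n) L L' \<and> (\<exists>t\<in>T. labels 0 t L')"
  using assms
proof (induction n arbitrary: S s L)
  case 0
  then show ?case by auto
next
  case (Suc n)
  obtain S' where S': "(S, S') \<in> tree_rstep (star_sig \<Sigma>) X (star_rules \<Sigma> gt X)"
    "(S', T) \<in> tree_rstep (star_sig \<Sigma>) X (star_rules \<Sigma> gt X) ^^ n"
    using relpow_Suc_D2[OF Suc.prems(1)] by blast
  from labels_tree_step[OF S'(1) Suc.prems(2,3)] Suc.IH[OF S'(2)] show ?case
    by (meson relpowp_Suc_I2)
qed

lemma trees_subset_terms: "T \<in> trees \<Gamma> X \<Longrightarrow> T \<subseteq> terms \<Gamma> X"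
  by (auto simp: trees_def quotient_def tree_eq_def)

lemma trees_nonempty: "T \<in> trees \<Gamma> X \<Longrightarrow> T \<noteq> {}"
  by (auto simp: trees_def quotient_def tree_eq_def)

section \<open>Termination on star-free trees\<close>

theorem theorem3p7:
  fixes \<Sigma> :: "'f set" and X :: "'v set" and gt :: "'f \<Rightarrow> 'f \<Rightarrow> bool"
  assumes "infinite X"
    and "irreflp_on \<Sigma> gt" and "transp_on \<Sigma> gt"
    and "wfp_on \<Sigma> (\<lambda>f g. gt g f)"
  shows "\<nexists>t :: nat \<Rightarrow> ('f starred, 'v) tree. \<forall>i.
    (t i, t (Suc i)) \<in> (tree_rstep (star_sig \<Sigma>) X (star_rules \<Sigma> gt X))\<^sup>+
      \<inter> trees (Plain ` \<Sigma>) X \<times> trees (Plain ` \<Sigma>) X"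
proof
  let ?R = "tree_rstep (star_sig \<Sigma>) X (star_rules \<Sigma> gt X)"
  \<comment> \<open>Restricting the order to \<open>\<Sigma>\<close> turns well-foundedness on
    \<open>\<Sigma>\<close> into well-foundedness on the whole type.\<close>
  define gt' where "gt' = (\<lambda>f g. f \<in> \<Sigma> \<and> g \<in> \<Sigma> \<and> gt f g)"
  assume "\<exists>t :: nat \<Rightarrow> ('f starred, 'v) tree. \<forall>i.
    (t i, t (Suc i)) \<in> ?R\<^sup>+ \<inter> trees (Plain ` \<Sigma>) X \<times> trees (Plain ` \<Sigma>) X"
  then obtain t :: "nat \<Rightarrow> ('f starred, 'v) tree" where
    step: "\<And>i. (t i, t (Suc i)) \<in> ?R\<^sup>+" and tree: "\<And>i. t i \<in> trees (Plain ` \<Sigma>) X"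
    by blast
  have "wfp (\<lambda>f g. gt' g f)"
    using assms(4) unfolding wfp_on_iff_wfp[of \<Sigma>] gt'_def by (simp add: conj_ac)
  then have wf: "wfp ((lstep gt' :: ('f, 'v) ltree \<Rightarrow> _)\<^sup>+\<^sup>+)\<inverse>\<inverse>"
    by (rule wfp_lstep_tranclp)
  \<comment> \<open>The induction runs over the labelled tree while \<open>i\<close> and the
    representative \<open>s\<close> vary: moving on to \<open>t (Suc i)\<close> strictly descends
    from \<open>L\<close>.\<close>
  have no_labels: "\<not> labels 0 s L" if "s \<in> t i" for s i L
    using that
  proof (induction L arbitrary: i s rule: wfp_induct_rule[OF wf])
    case (1 L)
    show ?case
    proof
      assume L: "labels 0 s L"
      obtain n where n: "n > 0" "(t i, t (Suc i)) \<in> ?R ^^ n"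
        using step[of i] by (auto simp: trancl_power)
      \<comment> \<open>The length \<open>n\<close> is known only now; as \<open>s\<close> is
        star-free, its labelling \<open>L\<close> for bound 0 also serves for bound
        \<open>n\<close>.\<close>
      have "labels n s L"
        using labels_star_free[OF L] trees_subset_terms[OF tree] 1(2) by blast
      from labels_tree_steps[OF n(2) 1(2) this] obtain L' u where
        "(lstep gt' ^^ n) L L'" "u \<in> t (Suc i)" "labels 0 u L'"
        unfolding gt'_def by blast
      \<comment> \<open>\<open>n > 0\<close> excludes the empty reduction, which would give no
        descent.\<close>
      moreover from this n(1) have "(lstep gt')\<^sup>+\<^sup>+ L L'"
        by (auto simp: tranclp_power)
      ultimately show False using 1(1) by blast
    qed
  qed
  obtain s where "s \<in> t 0" using trees_nonempty[OF tree] by blast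
  with no_labels ex_labels show False by blast
qed

end
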